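(* Let $(M,g)$ be the Robinson–Trautman spacetime with coordinates $(t,r,x,y)$, constants $a,b,d\in\mathbb R$ and function $f=f(x,y)$. If $f_x=0$ (i.e. $f$ is a function of $y$ only), and $f_y^2-ff_{yy}-2a+4br\neq0$ and $r\{f_y^2-ff_{yy}\}-2ar+6d\neq0$ on $M$, then the spacetime possesses conharmonic collineation with respect to $\xi=\frac{\partial}{\partial x}$, i.e. $\mathscr L_\xi K=0$.
   Context: Robinson–Trautman (RT) spacetime: $a,b,d\in\mathbb R$ are constants; $M=I\times J\times\Omega$ with coordinates $(x^1,x^2,x^3,x^4)=(t,r,x,y)$, where $I\subset\mathbb R$ and $J\subset\mathbb R\setminus\{0\}$ are open intervals and $\Omega\subset\mathbb R^2$ is open, connected and nonempty; $f:\Omega\to\mathbb R$ is smooth and nowhere vanishing, with subscripts denoting partial derivatives; the metric is $$g=-2\Big(a-2br-\frac dr\Big)dt^2+2\,dt\,dr-\frac{r^2}{f^2}(dx^2+dy^2).$$ ($2\,dt\,dr$ means $g_{12}=g_{21}=1$.) Curvature conventions: with $\Gamma$ the Levi-Civita connection coefficients, $R_{pqrs}=g_{p\alpha}(\partial_r\Gamma^\alpha_{qs}-\partial_s\Gamma^\alpha_{qr}+\Gamma^\beta_{qs}\Gamma^\alpha_{\beta r}-\Gamma^\beta_{qr}\Gamma^\alpha_{\beta s})$ and $S_{qr}=g^{ps}R_{pqrs}$. The Kulkarni–Nomizu product is $(\phi\wedge\psi)_{pqrs}=\phi_{ps}\psi_{qr}-\phi_{pr}\psi_{qs}+\phi_{qr}\psi_{ps}-\phi_{qs}\psi_{pr}$.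 The conharmonic $(0,4)$ curvature tensor (dimension 4) is $K=R-\frac12\,S\wedge g$; $\mathscr L_\xi$ is the Lie derivative of the $(0,4)$ tensor. *)

theory Defs
  imports "HOL-Analysis.Analysis"
begin

definition pd :: "'n \<Rightarrow> (real^'n \<Rightarrow> real) \<Rightarrow> real^'n \<Rightarrow> real" where
  "pd i F p = deriv (\<lambda>h. F (p + h *\<^sub>R axis i 1)) 0"

text \<open>On an open set, \<^term>\<open>smooth_on\<close> is the usual notion of class $C^\infty$.\<close>

primrec Ck_on :: "nat \<Rightarrow> (real^'n) set \<Rightarrow> (real^'n \<Rightarrow> real) \<Rightarrow> bool" where
  "Ck_on 0 S F \<longleftrightarrow> continuous_on S F"
| "Ck_on (Suc k) S F \<longleftrightarrow> (\<forall>p\<in>S. F differentiable (at p)) \<and> (\<forall>i. Ck_on k S (pd i F))"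

definition smooth_on :: "(real^'n) set \<Rightarrow> (real^'n \<Rightarrow> real) \<Rightarrow> bool" where
  "smooth_on S F \<longleftrightarrow> (\<forall>k. Ck_on k S F)"

text \<open>Tensors at a point are represented by their components in the fixed coordinate system.\<close>

type_synonym 'n tensor2 = "real^'n^'n"
type_synonym 'n tensor4 = "real^'n^'n^'n^'n"

text \<open>\<open>christoffel g p k i j\<close> is $\Gamma^k_{ij}$ of the Levi-Civita connection of \<open>g\<close>.\<close>

definition christoffel :: "(real^'n \<Rightarrow> 'n tensor2) \<Rightarrow> real^'n \<Rightarrow> 'n \<Rightarrow> 'n \<Rightarrow> 'n \<Rightarrow> real" where
  "christoffel g p k i j =
     1/2 * (\<Sum>l\<in>UNIV. matrix_inv (g p) $ k $ l *
       (pd i (\<lambda>u. g u $ j $ l) p + pd j (\<lambda>u. g u $ i $ l) p - pd l (\<lambda>u. g u $ i $ j) p))"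

definition riemann :: "(real^'n \<Rightarrow> 'n tensor2) \<Rightarrow> real^'n \<Rightarrow> 'n tensor4" where
  "riemann g u = (\<chi> p q r s. \<Sum>\<alpha>\<in>UNIV. g u $ p $ \<alpha> *
     (pd r (\<lambda>v. christoffel g v \<alpha> q s) u - pd s (\<lambda>v. christoffel g v \<alpha> q r) u
      + (\<Sum>\<beta>\<in>UNIV. christoffel g u \<beta> q s * christoffel g u \<alpha> \<beta> r)
      - (\<Sum>\<beta>\<in>UNIV. christoffel g u \<beta> q r * christoffel g u \<alpha> \<beta> s)))"

definition ricci :: "(real^'n \<Rightarrow> 'n tensor2) \<Rightarrow> real^'n \<Rightarrow> 'n tensor2" where
  "ricci g u = (\<chi> q r. \<Sum>p\<in>UNIV. \<Sum>s\<in>UNIV. matrix_inv (g u) $ p $ s * riemann g u $ p $ q $ r $ s)"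

definition kulkarni_nomizu :: "'n tensor2 \<Rightarrow> 'n tensor2 \<Rightarrow> 'n::finite tensor4" where
  "kulkarni_nomizu \<phi> \<psi> = (\<chi> p q r s.
     \<phi> $ p $ s * \<psi> $ q $ r - \<phi> $ p $ r * \<psi> $ q $ s
     + \<phi> $ q $ r * \<psi> $ p $ s - \<phi> $ q $ s * \<psi> $ p $ r)"

text \<open>The factor $1/2$ is $1/(n-2)$ for dimension $n = 4$.\<close>

definition conharmonic :: "(real^4 \<Rightarrow> 4 tensor2) \<Rightarrow> real^4 \<Rightarrow> 4 tensor4" where
  "conharmonic g u = riemann g u - (1/2) *\<^sub>R kulkarni_nomizu (ricci g u) (g u)"

definition lie_derivative ::
  "(real^'n \<Rightarrow> real^'n) \<Rightarrow> (real^'n \<Rightarrow> 'n tensor4) \<Rightarrow> real^'n \<Rightarrow> 'n tensor4" where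
  "lie_derivative \<xi> T u = (\<chi> p q r s. \<Sum>\<alpha>\<in>UNIV.
     \<xi> u $ \<alpha> * pd \<alpha> (\<lambda>v. T v $ p $ q $ r $ s) u
     + T u $ \<alpha> $ q $ r $ s * pd p (\<lambda>v. \<xi> v $ \<alpha>) u
     + T u $ p $ \<alpha> $ r $ s * pd q (\<lambda>v. \<xi> v $ \<alpha>) u
     + T u $ p $ q $ \<alpha> $ s * pd r (\<lambda>v. \<xi> v $ \<alpha>) u
     + T u $ p $ q $ r $ \<alpha> * pd s (\<lambda>v. \<xi> v $ \<alpha>) u)"

text \<open>Components \<open>1, 2, 3, 4\<close> of a point of \<^typ>\<open>real^4\<close> are the coordinates $t, r, x, y$;
  components \<open>1, 2\<close> of a point of \<^typ>\<open>real^2\<close> are $x, y$.\<close>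

definition xy :: "real^4 \<Rightarrow> real^2" where
  "xy p = vector [p $ 3, p $ 4]"

definition rt_domain :: "real set \<Rightarrow> real set \<Rightarrow> (real^2) set \<Rightarrow> (real^4) set" where
  "rt_domain I J \<Omega> = {p. p $ 1 \<in> I \<and> p $ 2 \<in> J \<and> xy p \<in> \<Omega>}"

definition rt_metric :: "real \<Rightarrow> real \<Rightarrow> real \<Rightarrow> (real^2 \<Rightarrow> real) \<Rightarrow> real^4 \<Rightarrow> 4 tensor2" where
  "rt_metric a b d f p =
     (let r = p $ 2; h = - (r\<^sup>2 / (f (xy p))\<^sup>2) in
      vector [vector [-2 * (a - 2 * b * r - d / r), 1, 0, 0],
              vector [1, 0, 0, 0],
              vector [0, 0, h, 0],
              vector [0, 0, 0, h]])"

end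

theory Submission
  imports Defs
begin

text \<open>
  The reason for the statement is that \<open>\<partial>/\<partial>x\<close> is a Killing field: since \<open>f\<^sub>x = 0\<close>, the metric
  components do not change along the \<open>x\<close>-direction, and the flow of \<open>\<partial>/\<partial>x\<close> is translation in
  that direction. The conharmonic tensor is built from the metric by a coordinate formula in
  which the point does not occur explicitly, so it is invariant under the same translations,
  and its Lie derivative along \<open>\<partial>/\<partial>x\<close>, which in these coordinates is the partial derivative \<open>\<partial>/\<partial>x\<close> of the components,
  vanishes. No component of the curvature has to be computed.

  The only care needed is about domains. The set \<open>\<Omega>\<close> need not be convex in the
  \<open>x\<close>-direction, so that \<open>f\<close> can take different values on two parts of one line
  \<open>y = const\<close>, and outside \<open>\<Omega>\<close> nothing is known about \<open>f\<close>. Invariance is therefore stated for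
  small translations and for germs: \<open>F (v + c) = F v\<close> for all \<open>v\<close> near a given point. Partial
  derivatives depend only on germs, hence preserve this property (\<open>pd_translate\<close>,
  \<open>invariant_near_operator\<close>); so it passes through the Christoffel symbols and the Riemann and Ricci tensors to the
  conharmonic tensor (\<open>conharmonic_translate\<close>). For the metric it comes from the mean value
  theorem on a disc inside \<open>\<Omega>\<close> (\<open>rt_metric_invariant_near\<close>).
\<close>

section \<open>Germs invariant under a translation\<close>

definition invariant_near :: "'a::real_normed_vector \<Rightarrow> ('a \<Rightarrow> 'b) \<Rightarrow> 'a \<Rightarrow> bool" where
  "invariant_near c F p \<longleftrightarrow> (\<forall>\<^sub>F v in nhds p. F (v + c) = F v)"

lemma invariant_nearD: "invariant_near c F p \<Longrightarrow> F (p + c) = F p"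
  unfolding invariant_near_def by (rule eventually_nhds_x_imp_x)

lemma invariant_near_compose: "invariant_near c F p \<Longrightarrow> invariant_near c (\<lambda>v. T (F v)) p"
  unfolding invariant_near_def by (auto elim: eventually_mono)

text \<open>
  For an operator \<open>T\<close> it suffices to compare values at single points: the set of points around
  which a germ is invariant is open, so a pointwise conclusion holds on a whole neighbourhood.
\<close>

lemma invariant_near_operator:
  assumes pointwise: "\<And>q. invariant_near c F q \<Longrightarrow> T (q + c) = T q"
    and "invariant_near c F p"
  shows "invariant_near c T p"
proof -
  have "\<forall>\<^sub>F q in nhds p. invariant_near c F q"
    using assms(2) unfolding invariant_near_def by (simp add: eventually_eventually)
  then show ?thesis
    unfolding invariant_near_def[of c T] by (rule eventually_mono) (rule pointwise)
qed

lemma pd_translate: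
  assumes "invariant_near c F p"
  shows "pd i F (p + c) = pd i F p"
proof -
  have "((\<lambda>h. p + h *\<^sub>R axis i 1) \<longlongrightarrow> p + 0 *\<^sub>R axis i 1) (nhds (0::real))"
    by (intro tendsto_intros filterlim_ident)
  then have "\<forall>\<^sub>F h in nhds 0. F (p + h *\<^sub>R axis i 1 + c) = F (p + h *\<^sub>R axis i 1)"
    using assms eventually_compose_filterlim[where P = "\<lambda>v. F (v + c) = F v"]
    unfolding invariant_near_def by auto
  then have "\<forall>\<^sub>F h in nhds 0. F (p + c + h *\<^sub>R axis i 1) = F (p + h *\<^sub>R axis i 1)"
    by (simp add: add_ac)
  then show ?thesis
    unfolding pd_def by (rule deriv_cong_ev) simp
qed

section \<open>Curvature of a translation-invariant metric\<close>

lemma christoffel_translate: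
  assumes "invariant_near c g p"
  shows "christoffel g (p + c) k i j = christoffel g p k i j"
proof -
  have "pd m (\<lambda>u. g u $ n $ l) (p + c) = pd m (\<lambda>u. g u $ n $ l) p" for m n l
    by (rule pd_translate) (rule invariant_near_compose[OF assms])
  then show ?thesis
    unfolding christoffel_def using invariant_nearD[OF assms] by simp
qed

lemma riemann_translate:
  assumes "invariant_near c g p"
  shows "riemann g (p + c) = riemann g p"
proof -
  have "invariant_near c (\<lambda>v. christoffel g v k i j) p" for k i j
    by (rule invariant_near_operator[OF _ assms]) (rule christoffel_translate)
  then have "pd m (\<lambda>v. christoffel g v k i j) (p + c) = pd m (\<lambda>v. christoffel g v k i j) p"
    for m k i j
    by (rule pd_translate)
  then show ?thesis
    unfolding riemann_def
    using invariant_nearD[OF assms] christoffel_translate[OF assms] by simp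
qed

lemma ricci_translate: "invariant_near c g p \<Longrightarrow> ricci g (p + c) = ricci g p"
  unfolding ricci_def by (simp add: riemann_translate invariant_nearD)

lemma conharmonic_translate:
  "invariant_near c g p \<Longrightarrow> conharmonic g (p + c) = conharmonic g p"
  unfolding conharmonic_def by (simp add: riemann_translate ricci_translate invariant_nearD)

section \<open>Lie derivative along a coordinate field\<close>

text \<open>
  Only the derivative of the tensor along the flow survives, since the components of a coordinate
  field are constant.
\<close>

lemma lie_derivative_axis_eq_0:
  fixes T :: "real^'n \<Rightarrow> 'n tensor4"
  assumes "\<forall>\<^sub>F h in nhds 0. T (u + h *\<^sub>R axis k 1) = T u"
  shows "lie_derivative (\<lambda>_. axis k 1) T u = 0"
proof -
  have const: "pd m (\<lambda>_. C) u = 0" for m :: 'n and C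
    unfolding pd_def by simp
  have "pd k (\<lambda>v. T v $ p $ q $ r $ s) u = 0" for p q r s
  proof -
    have "\<forall>\<^sub>F h in nhds 0. T (u + h *\<^sub>R axis k 1) $ p $ q $ r $ s = T u $ p $ q $ r $ s"
      using assms by (auto elim: eventually_mono)
    then have "pd k (\<lambda>v. T v $ p $ q $ r $ s) u = deriv (\<lambda>_. T u $ p $ q $ r $ s) 0"
      unfolding pd_def by (rule deriv_cong_ev) simp
    then show ?thesis by simp
  qed
  then have along: "axis k 1 $ \<alpha> * pd \<alpha> (\<lambda>v. T v $ p $ q $ r $ s) u = 0" for \<alpha> p q r s
    by (cases "\<alpha> = k") (simp_all add: axis_def)
  show ?thesis
    unfolding lie_derivative_def by (simp add: const along vec_eq_iff)
qed

section \<open>Invariance of the Robinson--Trautman metric\<close>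

lemma const_along_axis_if_pd_eq_0:
  fixes F :: "real^'n \<Rightarrow> real"
  assumes diff: "\<And>v. v \<in> S \<Longrightarrow> F differentiable (at v)"
    and pd0: "\<And>v. v \<in> S \<Longrightarrow> pd i F v = 0"
    and seg: "closed_segment u (u + h *\<^sub>R axis i 1) \<subseteq> S"
  shows "F (u + h *\<^sub>R axis i 1) = F u"
proof -
  let ?e = "axis i 1 :: real^'n"
  have "((\<lambda>t. F (u + (t * h) *\<^sub>R ?e)) has_real_derivative 0) (at t)"
    if "t \<in> {0..1}" for t
  proof -
    let ?v = "u + (t * h) *\<^sub>R ?e"
    have "?v \<in> closed_segment u (u + h *\<^sub>R ?e)"
      unfolding in_segment using that by (auto intro!: exI[of _ t] simp: algebra_simps)
    then have v: "?v \<in> S"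
      using seg by blast
    then obtain D where "(F has_derivative D) (at ?v)"
      using diff unfolding differentiable_def by blast
    then have "((\<lambda>s. F (?v + s *\<^sub>R ?e)) has_derivative (\<lambda>s. D (s *\<^sub>R ?e))) (at 0)"
      by (intro has_derivative_compose[of "\<lambda>s. ?v + s *\<^sub>R ?e" "\<lambda>s. s *\<^sub>R ?e" 0 UNIV F D])
        (auto intro!: derivative_eq_intros)
    then have "(\<lambda>s. F (?v + s *\<^sub>R ?e)) differentiable (at 0)"
      unfolding differentiable_def by blast
    then have "((\<lambda>s. F (?v + s *\<^sub>R ?e)) has_real_derivative pd i F ?v) (at 0)"
      unfolding pd_def
      by (simp add: DERIV_deriv_iff_real_differentiable)
    \<comment> \<open>\<^const>\<open>pd\<close> differentiates at \<open>0\<close>; the substitution \<open>s \<mapsto> (s - t) * h\<close> moves this to the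
      parameter \<open>t\<close> of the segment.\<close>
    then have d0: "((\<lambda>s. F (?v + s *\<^sub>R ?e)) has_real_derivative 0) (at ((t - t) * h))"
      using pd0[OF v] by simp
    have "((\<lambda>s. F (?v + ((s - t) * h) *\<^sub>R ?e)) has_real_derivative 0 * h) (at t)"
      by (rule DERIV_chain2[where g = "\<lambda>s. (s - t) * h", OF d0])
        (auto intro!: derivative_eq_intros)
    then show ?thesis
      by (simp add: algebra_simps)
  qed
  then have "(\<lambda>t. F (u + (t * h) *\<^sub>R ?e)) 1 = (\<lambda>t. F (u + (t * h) *\<^sub>R ?e)) 0"
    by (intro DERIV_isconst2[of 0 1])
      (auto intro!: DERIV_atLeastAtMost_imp_continuous_on)
  then show ?thesis by simp
qed

lemma xy_translate: "xy (v + h *\<^sub>R axis 3 1) = xy v + h *\<^sub>R axis 1 1"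
  by (simp add: xy_def vec_eq_iff forall_2 axis_def)

lemma continuous_xy: "continuous_on UNIV xy"
proof -
  have xy_eq: "xy = (\<lambda>v. \<chi> i. if i = 1 then v $ 3 else v $ 4)"
    by (simp add: fun_eq_iff xy_def vec_eq_iff forall_2)
  have "continuous_on UNIV (\<lambda>v :: real^4. if i = 1 then v $ 3 else v $ 4)" for i :: 2
    by (cases "i = 1") (auto intro!: continuous_intros)
  then show ?thesis
    unfolding xy_eq by (rule continuous_on_vec_lambda)
qed

lemma rt_metric_invariant_near:
  assumes "open \<Omega>" and "\<And>u. u \<in> \<Omega> \<Longrightarrow> f differentiable (at u)"
    and "\<And>u. u \<in> \<Omega> \<Longrightarrow> pd 1 f u = 0" and "xy p \<in> \<Omega>"
  shows "\<forall>\<^sub>F h in nhds 0. invariant_near (h *\<^sub>R axis 3 1) (rt_metric a b d f) p"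
proof -
  obtain e where e: "e > 0" "ball (xy p) e \<subseteq> \<Omega>"
    using assms by (auto simp: open_contains_ball)
  \<comment> \<open>Half the radius is spent on the base point and half on the translation, which keeps the
    segment between the two points in the disc.\<close>
  have "invariant_near (h *\<^sub>R axis 3 1) (rt_metric a b d f) p" if h: "\<bar>h\<bar> < e / 2" for h
  proof -
    have "open (xy -` ball (xy p) (e / 2))"
      by (rule open_vimage[OF open_ball continuous_xy])
    then have "\<forall>\<^sub>F v in nhds p. v \<in> xy -` ball (xy p) (e / 2)"
      by (rule eventually_nhds_in_open) (use e in simp)
    then show ?thesis
      unfolding invariant_near_def
    proof (rule eventually_mono)
      fix v assume "v \<in> xy -` ball (xy p) (e / 2)"
      then have near: "dist (xy p) (xy v) < e / 2" by simp
      have "dist (xy v) (xy v + h *\<^sub>R axis 1 1) < e / 2"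
        using h by (simp add: dist_norm)
      then have "dist (xy p) (xy v + h *\<^sub>R axis 1 1) < e"
        using near dist_triangle[of "xy p" "xy v + h *\<^sub>R axis 1 1" "xy v"] by linarith
      then have "closed_segment (xy v) (xy v + h *\<^sub>R axis 1 1) \<subseteq> ball (xy p) e"
        using near e by (intro closed_segment_subset) auto
      then have "f (xy v + h *\<^sub>R axis 1 1) = f (xy v)"
        using e assms by (intro const_along_axis_if_pd_eq_0[of \<Omega>]) auto
      then show "rt_metric a b d f (v + h *\<^sub>R axis 3 1) = rt_metric a b d f v"
        unfolding rt_metric_def xy_translate by (simp add: axis_def)
    qed
  qed
  then have "\<forall>h. dist h 0 < e / 2 \<longrightarrow>
      invariant_near (h *\<^sub>R axis 3 1) (rt_metric a b d f) p"
    by simp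
  then show ?thesis
    unfolding eventually_nhds_metric using e by (intro exI[of _ "e / 2"]) auto
qed

section \<open>Conharmonic collineation\<close>

theorem corollary4p8:
  fixes a b d :: real
    and I J :: "real set"
    and \<Omega> :: "(real^2) set"
    and f :: "real^2 \<Rightarrow> real"
  assumes "open I" and "is_interval I" and "I \<noteq> {}"
    and "open J" and "is_interval J" and "J \<noteq> {}" and "0 \<notin> J"
    and "open \<Omega>" and "connected \<Omega>" and "\<Omega> \<noteq> {}"
    and "smooth_on \<Omega> f" and "\<And>u. u \<in> \<Omega> \<Longrightarrow> f u \<noteq> 0"
    and "\<And>u. u \<in> \<Omega> \<Longrightarrow> pd 1 f u = 0"
    and "\<And>p. p \<in> rt_domain I J \<Omega> \<Longrightarrow>
      (pd 2 f (xy p))\<^sup>2 - f (xy p) * pd 2 (pd 2 f) (xy p) - 2 * a + 4 * b * p $ 2 \<noteq> 0"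
    and "\<And>p. p \<in> rt_domain I J \<Omega> \<Longrightarrow>
      p $ 2 * ((pd 2 f (xy p))\<^sup>2 - f (xy p) * pd 2 (pd 2 f) (xy p)) - 2 * a * p $ 2 + 6 * d \<noteq> 0"
  shows "\<forall>p \<in> rt_domain I J \<Omega>.
    lie_derivative (\<lambda>_. axis 3 1) (conharmonic (rt_metric a b d f)) p = 0"
proof
  fix p assume "p \<in> rt_domain I J \<Omega>"
  then have p: "xy p \<in> \<Omega>"
    by (simp add: rt_domain_def)
  have "Ck_on 1 \<Omega> f"
    using \<open>smooth_on \<Omega> f\<close> unfolding smooth_on_def by blast
  then have "f differentiable (at u)" if "u \<in> \<Omega>" for u
    using that by simp
  then have "\<forall>\<^sub>F h in nhds 0. invariant_near (h *\<^sub>R axis 3 1) (rt_metric a b d f) p"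
    using \<open>open \<Omega>\<close> assms(13) p by (intro rt_metric_invariant_near)
  then have "\<forall>\<^sub>F h in nhds 0. conharmonic (rt_metric a b d f) (p + h *\<^sub>R axis 3 1)
      = conharmonic (rt_metric a b d f) p"
    by (rule eventually_mono) (rule conharmonic_translate)
  then show "lie_derivative (\<lambda>_. axis 3 1) (conharmonic (rt_metric a b d f)) p = 0"
    by (rule lie_derivative_axis_eq_0)
qed

end
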